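(* Let $c>0$, $\theta\in(0,1]$ and let $n>c$ be an integer with $\theta n\ge1$. For the Erdős–Rényi random graph $G(n,c/n)$ let $\mathcal{C}^n_{\max}$ be the size of the largest connected component, $t_n(k)$ the number of connected components of size $k$, and $C_n$ the total number of connected components. Then for all $(\gamma_k)\in\mathbb{N}^{\lfloor\theta n\rfloor}$ with $\sum_{k=1}^{\lfloor\theta n\rfloor}k\gamma_k=n$, $$\mathbb{P}\left(t_n(k)=\gamma_k,\,1\le k\le\lfloor\theta n\rfloor\,\Big|\,\mathcal{C}^n_{\max}\le\lfloor\theta n\rfloor\right)=\mathbb{P}\left(\sum_{i=1}^{N(Z^\theta_{n,c}n)}\mathbf{1}_{\{X_i^{n,\theta}=k\}}=\gamma_k,\,1\le k\le\lfloor\theta n\rfloor\,\Big|\,\sum_{i=1}^{N(Z^\theta_{n,c}n)}X_i^{n,\theta}=n\right).$$ Moreover, $$\mathbb{P}\left(\sum_{i=1}^{N(Z^\theta_{n,c}n)}X_i^{n,\theta}=n\right)=\frac{e^{-Z^\theta_{n,c}n}\,n^n\,(1-c/n)^{\frac12n^2}}{n!}\,\mathbb{P}\left(\mathcal{C}^n_{\max}\le\lfloor\theta n\rfloor\right);$$ for all $1\le j\le\lfloor\theta n\rfloor$, $$\mathbb{P}\left(\mathcal{C}^n_{\max}=j\,\Big|\,\mathcal{C}^n_{\max}\le\lfloor\theta n\rfloor\right)=\mathbb{P}\left(\max_{1\le i\le N(Z^\theta_{n,c}n)}X_i^{n,\theta}=j\,\Big|\,\sum_{i=1}^{N(Z^\theta_{n,c}n)}X_i^{n,\theta}=n\right);$$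 and for all integers $\ell\ge1$, $$\mathbb{P}\left(C_n=\ell\,\Big|\,\mathcal{C}^n_{\max}\le\lfloor\theta n\rfloor\right)=\mathbb{P}\left(N(Z^\theta_{n,c}n)=\ell\,\Big|\,\sum_{i=1}^{N(Z^\theta_{n,c}n)}X_i^{n,\theta}=n\right).$$
   Context: $\mathbb{N}=\{0,1,2,\dots\}$. $G(n,p)$ is the random graph on $\{1,\dots,n\}$ in which each edge is present independently with probability $p$; $\mu_k(p)$ is the probability that $G(k,p)$ is connected ($\mu_1(p)=1$). $(X_i^{n,\theta})_{i\ge1}$ are i.i.d. random variables on $\{1,\dots,\lfloor\theta n\rfloor\}$ with common law (that of $X^{n,\theta}$) $$\mathbb{P}(X^{n,\theta}=k)=\frac{1}{Z^\theta_{n,c}}\,\frac{n^{k-1}\mu_k(c/n)(1-c/n)^{kn-\frac12k^2}}{k!},\quad 1\le k\le\lfloor\theta n\rfloor,$$ where $Z^\theta_{n,c}=\sum_{k=1}^{\lfloor\theta n\rfloor}\frac{n^{k-1}\mu_k(c/n)(1-c/n)^{kn-\frac12k^2}}{k!}$. $N(Z^\theta_{n,c}n)$ is a Poisson random variable with mean $Z^\theta_{n,c}n$, independent of $(X_i^{n,\theta})_{i\ge1}$. *)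

theory Defs
  imports "HOL-Probability.Probability"
begin

text \<open>A graph on a vertex set \<open>V\<close> is given by its set of edges, each edge being a two-element
  subset of \<open>V\<close>.\<close>

definition all_edges :: "nat \<Rightarrow> nat set set"
  where "all_edges n = {e. e \<subseteq> {1..n} \<and> card e = 2}"

definition adj :: "'a set set \<Rightarrow> ('a \<times> 'a) set"
  where "adj G = {(u, v). {u, v} \<in> G}"

definition connected_graph :: "'a set \<Rightarrow> 'a set set \<Rightarrow> bool"
  where "connected_graph V G \<longleftrightarrow> V \<noteq> {} \<and> (\<forall>u\<in>V. \<forall>v\<in>V. (u, v) \<in> (adj G)\<^sup>*)"

definition component_of :: "'a set \<Rightarrow> 'a set set \<Rightarrow> 'a \<Rightarrow> 'a set"
  where "component_of V G u = {v \<in> V. (u, v) \<in> (adj G)\<^sup>*}"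

definition components :: "'a set \<Rightarrow> 'a set set \<Rightarrow> 'a set set"
  where "components V G = component_of V G ` V"

definition num_components :: "nat \<Rightarrow> nat set set \<Rightarrow> nat"
  where "num_components n G = card (components {1..n} G)"

definition num_components_of_size :: "nat \<Rightarrow> nat \<Rightarrow> nat set set \<Rightarrow> nat"
  where "num_components_of_size n k G = card {C \<in> components {1..n} G. card C = k}"

definition max_component_size :: "nat \<Rightarrow> nat set set \<Rightarrow> nat"
  where "max_component_size n G = Max (card ` components {1..n} G)"

definition gnp :: "nat \<Rightarrow> real \<Rightarrow> nat set set pmf"
  where "gnp n p =
    map_pmf (\<lambda>present. {e \<in> all_edges n. present e})
      (Pi_pmf (all_edges n) False (\<lambda>_. bernoulli_pmf p))"

definition mu :: "nat \<Rightarrow> real \<Rightarrow> real"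
  where "mu k p = \<P>(G in measure_pmf (gnp k p). connected_graph {1..k} G)"

abbreviation cutoff :: "real \<Rightarrow> nat \<Rightarrow> nat"
  where "cutoff \<theta> n \<equiv> nat \<lfloor>\<theta> * real n\<rfloor>"

definition weight :: "nat \<Rightarrow> real \<Rightarrow> nat \<Rightarrow> real"
  where "weight n c k =
    real n ^ (k - 1) * mu k (c / real n)
      * (1 - c / real n) powr (real k * real n - (real k)\<^sup>2 / 2) / fact k"

definition Z :: "nat \<Rightarrow> real \<Rightarrow> real \<Rightarrow> real"
  where "Z n c \<theta> = (\<Sum>k = 1..cutoff \<theta> n. weight n c k)"

definition X_law :: "nat \<Rightarrow> real \<Rightarrow> real \<Rightarrow> nat \<Rightarrow> real"
  where "X_law n c \<theta> k = (if k \<in> {1..cutoff \<theta> n} then weight n c k / Z n c \<theta> else 0)"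

lemma mu_1: "mu 1 p = 1"
  by (simp add: mu_def connected_graph_def)

lemma weight_nonneg: "0 \<le> weight n c k"
  by (simp add: weight_def mu_def)

lemma Z_pos:
  assumes "0 < c" "c < real n" "1 \<le> \<theta> * real n"
  shows "0 < Z n c \<theta>"
proof -
  have "0 < weight n c 1"
    using assms by (simp add: weight_def mu_1 del: One_nat_def)
  moreover have "1 \<in> {1..cutoff \<theta> n}"
    using assms(3) by (auto simp: le_nat_iff le_floor_iff)
  ultimately show ?thesis
    unfolding Z_def by (intro sum_pos2[where i = 1]) (auto simp: weight_nonneg)
qed

end

theory Submission
  imports Defs "HOL-Combinatorics.Multiset_Permutations"
begin

text \<open>Put \<open>p = c / n\<close>, \<open>q = 1 - p\<close>, \<open>r = p / q\<close>. A graph \<open>G\<close> has probability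
  \<open>q ^ (n choose 2) * r ^ card G\<close>, and \<open>r ^ card G\<close> factorises over the components of \<open>G\<close>. With
  \<open>a k = (\<Sum>G. r ^ card G)\<close> over the connected graphs on \<open>k\<close> vertices, a sequence \<open>ks\<close> of \<open>l\<close> positive
  sizes with sum \<open>n\<close> thus contributes \<open>q ^ (n choose 2) * n! / l! * (\<Prod>k\<leftarrow>ks. a k / k!)\<close> to the law of
  the multiset of component sizes. As \<open>mu k p = q ^ (k choose 2) * a k\<close>, the probability that
  \<open>N = l\<close> and \<open>(X 1, \<dots>, X l) = ks\<close> is the same expression times a constant independent of
  \<open>ks\<close>. All the statistics in question are functions of the multiset of sizes.\<close>

section \<open>Connected graphs on a vertex set and their weighted count\<close>

text \<open>Extends \<open>all_edges\<close> to any vertex set, since components are arbitrary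
  subsets of \<open>{1..n}\<close>.\<close>

definition edges_on :: "'a set \<Rightarrow> 'a set set"
  where "edges_on V = {e. e \<subseteq> V \<and> card e = 2}"

definition conn_graphs :: "'a set \<Rightarrow> 'a set set set"
  where "conn_graphs V = {G. G \<subseteq> edges_on V \<and> connected_graph V G}"

text \<open>For \<open>V = {1..k}\<close> this is the number \<open>a k\<close> of the idea above.
  It is indexed by sets because the blocks of a partition are arbitrary sets;
  \<open>conn_sum_card\<close> later removes the dependence on labels.\<close>

definition conn_sum :: "real \<Rightarrow> 'a set \<Rightarrow> real"
  where "conn_sum r V = (\<Sum>G\<in>conn_graphs V. r ^ card G)"

lemma finite_edges_on: "finite V \<Longrightarrow> finite (edges_on V)"
  unfolding edges_on_def by (rule finite_subset[of _ "Pow V"]) auto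

lemma card_edges_on: "finite V \<Longrightarrow> card (edges_on V) = card V choose 2"
  unfolding edges_on_def by (rule n_subsets)

lemma finite_conn_graphs: "finite V \<Longrightarrow> finite (conn_graphs V)"
  unfolding conn_graphs_def by (rule finite_subset[of _ "Pow (edges_on V)"]) (auto simp: finite_edges_on)

section \<open>Components as classes of the reachability relation\<close>

lemma sym_reach: "(u, v) \<in> (adj G)\<^sup>* \<Longrightarrow> (v, u) \<in> (adj G)\<^sup>*"
proof -
  have "sym (adj G)" by (auto simp: sym_def adj_def insert_commute)
  then show "(u, v) \<in> (adj G)\<^sup>* \<Longrightarrow> (v, u) \<in> (adj G)\<^sup>*"
    using sym_rtrancl symD by metis
qed

lemma reach_mono: "G \<subseteq> H \<Longrightarrow> (u, v) \<in> (adj G)\<^sup>* \<Longrightarrow> (u, v) \<in> (adj H)\<^sup>*"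
  using rtrancl_mono[of "adj G" "adj H"] by (auto simp: adj_def)

lemma component_of_eqI:
  assumes "v \<in> component_of V G u"
  shows "component_of V G v = component_of V G u"
  using assms unfolding component_of_def by (auto intro: rtrancl_trans dest: sym_reach)

text \<open>Reachability is an equivalence relation, so two components that share a vertex
  coincide.\<close>

lemma partition_on_components: "partition_on V (components V G)"
proof (rule partition_onI)
  show "\<Union>(components V G) = V"
    by (auto simp: components_def component_of_def)
  show "disjnt C D" if "C \<in> components V G" "D \<in> components V G" "C \<noteq> D" for C D
  proof -
    have "C = component_of V G x" if "x \<in> C" "C \<in> components V G" for x C
      using that component_of_eqI[of x V G] by (auto simp: components_def)
    then show ?thesis using that by (metis disjnt_iff)
  qed
  show "{} \<notin> components V G"
    by (auto simp: components_def component_of_def)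
qed

section \<open>Graphs as families of connected graphs on the blocks of a partition\<close>

lemma partition_on_part_unique: "partition_on V P \<Longrightarrow> A \<in> P \<Longrightarrow> B \<in> P \<Longrightarrow> x \<in> A \<Longrightarrow> x \<in> B \<Longrightarrow> A = B"
  by (metis disjnt_iff partition_on_def pairwiseD)

text \<open>Every edge of the union lies inside a single block. A path that starts in
  \<open>A\<close> therefore never leaves \<open>A\<close> and uses edges of \<open>h A\<close>
  only.\<close>

lemma reach_within_part:
  assumes P: "partition_on V P" and h: "\<And>A. A \<in> P \<Longrightarrow> h A \<subseteq> edges_on A"
    and A: "A \<in> P" "u \<in> A" and uv: "(u, v) \<in> (adj (\<Union>A\<in>P. h A))\<^sup>*"
  shows "v \<in> A \<and> (u, v) \<in> (adj (h A))\<^sup>*"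
  using uv
proof (induction rule: rtrancl_induct)
  case base
  then show ?case using A by simp
next
  case (step v w)
  then obtain B where B: "B \<in> P" "{v, w} \<in> h B" by (auto simp: adj_def)
  then have "{v, w} \<subseteq> B" using h[of B] by (auto simp: edges_on_def)
  moreover from this have "A = B" using partition_on_part_unique[OF P, of A B v] A B step by auto
  ultimately have "w \<in> A" "(v, w) \<in> adj (h A)" using B by (auto simp: adj_def)
  then show ?case using step by (auto intro: rtrancl_into_rtrancl)
qed

text \<open>No path leaves a block, and connectedness of \<open>h A\<close> joins all vertices of
  \<open>A\<close>. This is the gluing direction of the bijection behind
  \<open>sum_components_eq\<close>.\<close>

lemma components_UN:
  assumes P: "partition_on V P" and h: "\<And>A. A \<in> P \<Longrightarrow> h A \<in> conn_graphs A"
  shows "components V (\<Union>A\<in>P. h A) = P"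
proof -
  have hs: "h A \<subseteq> edges_on A" if "A \<in> P" for A using h[OF that] by (auto simp: conn_graphs_def)
  have comp: "component_of V (\<Union>A\<in>P. h A) u = A" if A: "A \<in> P" "u \<in> A" for A u
  proof (intro equalityI subsetI)
    fix v assume "v \<in> component_of V (\<Union>A\<in>P. h A) u"
    then show "v \<in> A"
      using reach_within_part[where h=h, OF P hs A] by (auto simp: component_of_def)
  next
    fix v assume v: "v \<in> A"
    then have "(u, v) \<in> (adj (h A))\<^sup>*" 
      using h[OF A(1)] A by (auto simp: conn_graphs_def connected_graph_def)
    then have "(u, v) \<in> (adj (\<Union>A\<in>P. h A))\<^sup>*"
      by (rule reach_mono[rotated]) (use A in blast)
    then show "v \<in> component_of V (\<Union>A\<in>P. h A) u"
      using v A P by (auto simp: component_of_def partition_on_def)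
  qed
  show ?thesis
  proof (intro equalityI subsetI)
    fix C assume "C \<in> components V (\<Union>A\<in>P. h A)"
    then obtain u where "u \<in> V" "C = component_of V (\<Union>A\<in>P. h A) u" by (auto simp: components_def)
    moreover from this obtain A where "A \<in> P" "u \<in> A" using P by (auto simp: partition_on_def)
    ultimately show "C \<in> P" using comp by simp
  next
    fix A assume A: "A \<in> P"
    then have "A \<noteq> {}" "A \<subseteq> V" using P by (auto simp: partition_on_def)
    then obtain u where u: "u \<in> A" "u \<in> V" by auto
    then show "A \<in> components V (\<Union>A\<in>P. h A)"
      unfolding components_def using comp[OF A u(1)] by (intro image_eqI[of _ _ u]) auto
  qed
qed

text \<open>The two ends of an edge reach each other, so no edge joins different components and
  restriction to the components loses nothing.\<close>

lemma edges_in_components: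
  assumes G: "G \<subseteq> edges_on V"
  shows "(\<Union>A\<in>components V G. G \<inter> Pow A) = G"
proof (intro equalityI subsetI)
  fix e assume e: "e \<in> G"
  then obtain u v where uv: "e = {u, v}" "u \<in> V" "v \<in> V"
  proof -
    have "e \<subseteq> V" "card e = 2" using G e by (auto simp: edges_on_def)
    then show ?thesis using that by (auto simp: card_2_iff)
  qed
  then have "(u, v) \<in> (adj G)\<^sup>*" using e by (auto simp: adj_def)
  then have "e \<subseteq> component_of V G u" using uv by (auto simp: component_of_def)
  then show "e \<in> (\<Union>A\<in>components V G. G \<inter> Pow A)" using e uv by (auto simp: components_def)
qed auto

text \<open>Vertices of \<open>A\<close> are joined by a path in \<open>G\<close>. With
  \<open>G\<close> written as the union of its restrictions, \<open>reach_within_part\<close> shows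
  that this path stays inside \<open>A\<close>.\<close>

lemma restrict_component_conn:
  assumes G: "G \<subseteq> edges_on V" and A: "A \<in> components V G"
  shows "G \<inter> Pow A \<in> conn_graphs A"
proof -
  have "(u, v) \<in> (adj (G \<inter> Pow A))\<^sup>*" if "u \<in> A" "v \<in> A" for u v
  proof -
    have "(u, v) \<in> (adj G)\<^sup>*"
      using A that by (auto simp: components_def component_of_def intro: rtrancl_trans dest: sym_reach)
    then show ?thesis
      using reach_within_part[OF partition_on_components, of V G "\<lambda>A. G \<inter> Pow A" A u v]
        edges_in_components[OF G] G A that by (auto simp: edges_on_def)
  qed
  moreover have "A \<noteq> {}" using A by (auto simp: components_def component_of_def)
  ultimately show ?thesis using G by (auto simp: conn_graphs_def connected_graph_def edges_on_def)
qed

text \<open>A graph with component partition \<open>P\<close> amounts to an independent choice of a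
  connected graph on each block. Edge counts add over the blocks, so the sum factorises.\<close>

lemma sum_components_eq:
  assumes fin: "finite V" and P: "partition_on V P"
  shows "(\<Sum>G | G \<subseteq> edges_on V \<and> components V G = P. r ^ card G) = (\<Prod>A\<in>P. conn_sum r A)"
proof -
  have fP: "finite P" using finite_elements[OF fin P] .
  have fA: "finite A" if "A \<in> P" for A using finite_subset[of A V] P that fin by (auto simp: partition_on_def)
  \<comment> \<open>An edge is nonempty and so cannot lie in two disjoint blocks; hence the family
    \<open>h\<close> can be recovered from its union.\<close>
  have inter: "(\<Union>B\<in>P. h B) \<inter> Pow A = h A" if h: "h \<in> PiE P conn_graphs" and A: "A \<in> P" for h A
  proof -
    have hs: "e \<subseteq> B \<and> card e = 2" if "B \<in> P" "e \<in> h B" for B e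
      using h that by (auto simp: PiE_def Pi_def conn_graphs_def edges_on_def)
    have "e \<in> h A" if e: "B \<in> P" "e \<in> h B" "e \<subseteq> A" for e B
    proof -
      obtain x where "x \<in> e" using hs[OF e(1,2)] by (cases "e = {}") auto
      then have "A = B" using partition_on_part_unique[OF P A e(1), of x] hs[OF e(1,2)] e by auto
      then show ?thesis using e by simp
    qed
    moreover have "e \<subseteq> A" if "e \<in> h A" for e using hs[OF A that] by simp
    ultimately show ?thesis using A by blast
  qed
  have "(\<Prod>A\<in>P. conn_sum r A) = (\<Sum>h\<in>PiE P conn_graphs. \<Prod>A\<in>P. r ^ card (h A))"
    unfolding conn_sum_def
    by (rule prod_sum_PiE) (auto intro: fP fA finite_conn_graphs)
  also have "\<dots> = (\<Sum>G | G \<subseteq> edges_on V \<and> components V G = P. r ^ card G)"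
  \<comment> \<open>Gluing and restricting are mutually inverse. The restricted lambda is needed
    because members of \<open>PiE\<close> are fixed to \<open>undefined\<close> outside
    \<open>P\<close>.\<close>
  proof (rule sum.reindex_bij_witness[where i = "\<lambda>G. \<lambda>A\<in>P. G \<inter> Pow A" and j = "\<lambda>h. \<Union>A\<in>P. h A"])
    fix h assume h: "h \<in> PiE P conn_graphs"
    show "restrict (\<lambda>A. (\<Union>B\<in>P. h B) \<inter> Pow A) P = h"
      using h inter[OF h] by (auto simp: fun_eq_iff restrict_def PiE_def extensional_def)
    have hc: "h A \<in> conn_graphs A" if "A \<in> P" for A using h that by auto
    have "h A \<subseteq> edges_on V" if "A \<in> P" for A
      using hc[OF that] that P by (fastforce simp: conn_graphs_def edges_on_def partition_on_def)
    then show "(\<Union>A\<in>P. h A) \<in> {G. G \<subseteq> edges_on V \<and> components V G = P}"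
      using components_UN[OF P hc] by auto
    have "card (\<Union>A\<in>P. h A) = (\<Sum>A\<in>P. card (h A))"
    proof (rule card_UN_disjoint[OF fP])
      show "\<forall>A\<in>P. finite (h A)"
        using hc finite_edges_on[OF fA] by (auto simp: conn_graphs_def dest: finite_subset)
      show "\<forall>A\<in>P. \<forall>B\<in>P. A \<noteq> B \<longrightarrow> h A \<inter> h B = {}"
      proof (intro ballI impI equals0I)
        fix A B e assume AB: "A \<in> P" "B \<in> P" "A \<noteq> B" "e \<in> h A \<inter> h B"
        then have "e \<subseteq> A" "e \<subseteq> B" "card e = 2" using hc[of A] hc[of B]
          by (auto simp: conn_graphs_def edges_on_def)
        moreover from this obtain x where "x \<in> e" by (cases "e = {}") auto
        ultimately show False using partition_on_part_unique[OF P AB(1,2), of x] AB by auto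
      qed
    qed
    then show "r ^ card (\<Union>A\<in>P. h A) = (\<Prod>A\<in>P. r ^ card (h A))" by (simp add: power_sum)
  next
    fix G assume "G \<in> {G. G \<subseteq> edges_on V \<and> components V G = P}"
    then have G: "G \<subseteq> edges_on V" "components V G = P" by auto
    show "(\<Union>A\<in>P. restrict (\<lambda>A. G \<inter> Pow A) P A) = G"
      using edges_in_components[OF G(1)] G(2) by simp
    show "(\<lambda>A\<in>P. G \<inter> Pow A) \<in> PiE P conn_graphs"
      using restrict_component_conn[OF G(1)] G(2) by auto
  qed
  finally show ?thesis ..
qed

section \<open>Invariance under relabelling of the vertices\<close>

lemma reach_image:
  "(u, v) \<in> (adj G)\<^sup>* \<Longrightarrow> (f u, f v) \<in> (adj ((`) f ` G))\<^sup>*"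
proof (induction rule: rtrancl_induct)
  case (step v w)
  then have "{v, w} \<in> G" by (simp add: adj_def)
  then have "f ` {v, w} \<in> (`) f ` G" by (rule imageI)
  then have "(f v, f w) \<in> adj ((`) f ` G)" by (simp add: adj_def)
  with step.IH show ?case by (rule rtrancl_into_rtrancl)
qed simp

lemma image_conn_graphs:
  assumes f: "bij_betw f V W" and G: "G \<in> conn_graphs V"
  shows "(`) f ` G \<in> conn_graphs W"
proof -
  have "f ` e \<subseteq> W \<and> card (f ` e) = 2" if "e \<in> G" for e
    using that G f inj_on_subset[of f V e] 
    by (auto simp: conn_graphs_def edges_on_def bij_betw_def card_image)
  moreover have "(x, y) \<in> (adj ((`) f ` G))\<^sup>*" if "x \<in> W" "y \<in> W" for x y
    using that f G reach_image[of _ _ G f]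
    by (auto simp: bij_betw_def conn_graphs_def connected_graph_def)
  moreover have "W \<noteq> {}" using f G by (auto simp: bij_betw_def conn_graphs_def connected_graph_def)
  ultimately show ?thesis by (auto simp: conn_graphs_def connected_graph_def edges_on_def)
qed

text \<open>Mapping every edge along \<open>f\<close> preserves connectedness and the number of
  edges, and is undone by mapping along the inverse of \<open>f\<close>.\<close>

lemma conn_sum_bij:
  assumes f: "bij_betw f V W"
  shows "conn_sum r V = conn_sum r W"
  unfolding conn_sum_def
proof (rule sum.reindex_bij_witness[where j = "\<lambda>G. (`) f ` G" and i = "\<lambda>G. (`) (inv_into V f) ` G"])
  have inv: "bij_betw (inv_into V f) W V" using f by (rule bij_betw_inv_into)
  show "(`) f ` G \<in> conn_graphs W" if "G \<in> conn_graphs V" for G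
    using image_conn_graphs[OF f that] .
  show "(`) (inv_into V f) ` G \<in> conn_graphs V" if "G \<in> conn_graphs W" for G
    using image_conn_graphs[OF inv that] .
  show "(`) (inv_into V f) ` (`) f ` G = G" if "G \<in> conn_graphs V" for G
  proof -
    have "inv_into V f ` f ` e = e" if "e \<in> G" for e
      using that \<open>G \<in> conn_graphs V\<close> f 
      by (intro inv_into_image_cancel) (auto simp: conn_graphs_def edges_on_def bij_betw_def)
    then have "(\<lambda>e. inv_into V f ` f ` e) ` G = (\<lambda>e. e) ` G" by (rule image_cong[OF refl])
    then show ?thesis by (simp add: image_image)
  qed
  show "(`) f ` (`) (inv_into V f) ` G = G" if "G \<in> conn_graphs W" for G
  proof -
    have "f ` inv_into V f ` e = e" if "e \<in> G" for e
      using that \<open>G \<in> conn_graphs W\<close> f 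
      by (intro image_inv_into_cancel) (auto simp: conn_graphs_def edges_on_def bij_betw_def)
    then have "(\<lambda>e. f ` inv_into V f ` e) ` G = (\<lambda>e. e) ` G" by (rule image_cong[OF refl])
    then show ?thesis by (simp add: image_image)
  qed
  show "r ^ card ((`) f ` G) = r ^ card G" if "G \<in> conn_graphs V" for G
  proof -
    have "inj_on ((`) f) G"
      using that f by (intro inj_on_subset[OF inj_on_image_Pow[of f V]])
        (auto simp: conn_graphs_def edges_on_def bij_betw_def)
    then show ?thesis by (simp add: card_image)
  qed
qed

lemma conn_sum_card:
  assumes "finite V"
  shows "conn_sum r V = conn_sum r {1..card V}"
proof -
  obtain f where "bij_betw f V {1..card V}"
    using finite_same_card_bij[OF assms, of "{1..card V}"] by auto
  then show ?thesis by (rule conn_sum_bij)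
qed

section \<open>From set partitions to sequences of block sizes\<close>

text \<open>The blocks form a list so that a sequence of sizes can be prescribed;
  \<open>distinct\<close> makes every partition into \<open>l\<close> blocks arise from exactly
  \<open>l!\<close> lists.\<close>

definition ordered_partitions :: "'a set \<Rightarrow> nat list \<Rightarrow> 'a set list set"
  where "ordered_partitions V ks = {As. distinct As \<and> partition_on V (set As) \<and> map card As = ks}"

definition component_sizes :: "'a set \<Rightarrow> 'a set set \<Rightarrow> nat multiset"
  where "component_sizes V G = image_mset card (mset_set (components V G))"

definition compositions :: "nat \<Rightarrow> nat list set"
  where "compositions n = {ks. 0 \<notin> set ks \<and> sum_list ks = n}"

text \<open>All parts are positive, so both the parts and their number are at most
  \<open>n\<close>.\<close>

lemma finite_compositions: "finite (compositions n)"
proof (rule finite_subset)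
  show "compositions n \<subseteq> {ks. set ks \<subseteq> {..n} \<and> length ks \<le> n}"
  proof
    fix ks assume "ks \<in> compositions n"
    then have ks: "0 \<notin> set ks" "sum_list ks = n" by (auto simp: compositions_def)
    then have "set ks \<subseteq> {..n}" using member_le_sum_list by fastforce
    moreover have "length ks \<le> sum_list ks" using ks(1) by (induction ks) auto
    ultimately show "ks \<in> {ks. set ks \<subseteq> {..n} \<and> length ks \<le> n}" using ks by auto
  qed
  show "finite {ks. set ks \<subseteq> {..n} \<and> length ks \<le> n}" by (rule finite_lists_length_le) simp
qed

text \<open>The first block is any \<open>k\<close>-subset, and the other blocks partition its
  complement. Since \<open>k > 0\<close>, that subset is nonempty, as a block must be.\<close>

lemma ordered_partitions_Cons:
  assumes "finite V" "k > 0"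
  shows "ordered_partitions V (k # ks) =
    (\<Union>A\<in>{A. A \<subseteq> V \<and> card A = k}. (#) A ` ordered_partitions (V - A) ks)"
proof (intro equalityI subsetI)
  fix As assume "As \<in> ordered_partitions V (k # ks)"
  then obtain A Bs where As: "As = A # Bs" "A \<notin> set Bs" "distinct Bs" "card A = k" "map card Bs = ks"
      and P: "partition_on V (insert A (set Bs))"
    by (auto simp: ordered_partitions_def Cons_eq_map_conv map_eq_Cons_conv)
  have "disjnt A (\<Union>(set Bs))"
    using partition_on_part_unique[OF P, of A] As(2) by (fastforce simp: disjnt_iff)
  then have "partition_on (V - A) (set Bs)" "A \<subseteq> V" using partition_on_insert P by blast+
  then show "As \<in> (\<Union>A\<in>{A. A \<subseteq> V \<and> card A = k}. (#) A ` ordered_partitions (V - A) ks)"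
    using As by (auto simp: ordered_partitions_def)
next
  fix As assume "As \<in> (\<Union>A\<in>{A. A \<subseteq> V \<and> card A = k}. (#) A ` ordered_partitions (V - A) ks)"
  then obtain A Bs where As: "A \<subseteq> V" "card A = k" "As = A # Bs" "distinct Bs" "map card Bs = ks"
      and P: "partition_on (V - A) (set Bs)"
    by (auto simp: ordered_partitions_def)
  have "disjnt A (\<Union>(set Bs))" using P by (auto simp: partition_on_def disjnt_iff)
  moreover have "A \<noteq> {}" using As assms by auto
  ultimately have "partition_on V (insert A (set Bs))" "A \<notin> set Bs"
    using partition_on_insert[of A "set Bs" V] P As by (auto simp: disjnt_iff)
  then show "As \<in> ordered_partitions V (k # ks)" using As by (auto simp: ordered_partitions_def)
qed

text \<open>This is the multinomial coefficient: the binomial coefficient for the first block times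
  the count for the remaining vertices.\<close>

lemma card_ordered_partitions:
  assumes "finite V" "ks \<in> compositions (card V)"
  shows "finite (ordered_partitions V ks) \<and>
    real (card (ordered_partitions V ks)) = fact (card V) / (\<Prod>k\<leftarrow>ks. fact k)"
  using assms
proof (induction ks arbitrary: V)
  case Nil
  then have "V = {}" by (simp add: compositions_def)
  then have "ordered_partitions V [] = {[]}" by (auto simp: ordered_partitions_def partition_on_def)
  then show ?case using \<open>V = {}\<close> by simp
next
  case (Cons k ks)
  define S where "S = {A. A \<subseteq> V \<and> card A = k}"
  have k: "k > 0" "k \<le> card V" using Cons.prems by (auto simp: compositions_def)
  have fS: "finite S" and cS: "card S = card V choose k"
    using Cons.prems(1) n_subsets[of V k] by (auto simp: S_def)
  have eq: "ordered_partitions V (k # ks) = (\<Union>A\<in>S. (#) A ` ordered_partitions (V - A) ks)"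
    unfolding S_def using Cons.prems(1) k(1) by (rule ordered_partitions_Cons)
  have VA: "card (V - A) = card V - k" if "A \<in> S" for A
    using that Cons.prems(1) card_Diff_subset[of A V] finite_subset[of A V] by (auto simp: S_def)
  have IH: "finite (ordered_partitions (V - A) ks)"
    "real (card (ordered_partitions (V - A) ks)) = fact (card V - k) / (\<Prod>k\<leftarrow>ks. fact k)" if "A \<in> S" for A
    using Cons.IH[of "V - A"] Cons.prems VA[OF that] by (auto simp: compositions_def)
  \<comment> \<open>Lists with different first blocks differ, so the cardinalities add up over
    \<open>A\<close>.\<close>
  have "card (ordered_partitions V (k # ks)) = (\<Sum>A\<in>S. card ((#) A ` ordered_partitions (V - A) ks))"
    unfolding eq by (rule card_UN_disjoint) (use fS IH in auto)
  also have "\<dots> = (\<Sum>A\<in>S. card (ordered_partitions (V - A) ks))"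
    by (intro sum.cong refl card_image) auto
  finally have "real (card (ordered_partitions V (k # ks))) =
      real (card V choose k) * (fact (card V - k) / (\<Prod>k\<leftarrow>ks. fact k))"
    using IH(2) cS by simp
  also have "\<dots> = fact (card V) / (\<Prod>k\<leftarrow>k # ks. fact k)"
    using k by (simp add: binomial_fact)
  finally show ?case using fS IH by (simp add: eq)
qed

text \<open>Each graph is counted through the \<open>l!\<close> orderings of its \<open>l\<close> components, which turns the sum
  over set partitions into one over sequences of component sizes.\<close>

lemma sum_graphs_by_component_sizes:
  fixes V :: "'a set"
  assumes fin: "finite V"
  shows "(\<Sum>G | G \<subseteq> edges_on V \<and> R (component_sizes V G). r ^ card G) =
    (\<Sum>ks\<in>{ks \<in> compositions (card V). R (mset ks)}.
       fact (card V) / fact (length ks) * (\<Prod>k\<leftarrow>ks. conn_sum r {1..k} / fact k))"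
    (is "?lhs = ?rhs")
proof -
  define b where "b k = conn_sum r {1..k}" for k :: nat
  have b: "conn_sum r A = b (card A)" if "finite A" for A :: "'a set"
    using conn_sum_card[OF that] by (simp add: b_def)
  define PP where "PP = {P. partition_on V P \<and> R (image_mset card (mset_set P))}"
  define Os where "Os = {As. distinct As \<and> set As \<in> PP}"
  \<comment> \<open>The factor \<open>1 / fact (length ks)\<close> compensates for counting each
    partition once per ordering of its blocks.\<close>
  define F where "F ks = (\<Prod>k\<leftarrow>ks. b k) / fact (length ks)" for ks
  have fPP: "finite PP"
    unfolding PP_def using finitely_many_partition_on[OF fin] by simp
  have fP: "finite P" if "P \<in> PP" for P using that finite_elements[OF fin] by (auto simp: PP_def)
  have fA: "finite A" if "partition_on V P" "A \<in> P" for A P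
    using finite_subset[of A V] that fin by (auto simp: partition_on_def)
  have perms: "{As \<in> Os. set As = P} = permutations_of_set P" if "P \<in> PP" for P
    using that by (auto simp: Os_def permutations_of_set_def)
  have fOO: "finite Os"
  proof (rule finite_subset)
    show "Os \<subseteq> (\<Union>P\<in>PP. permutations_of_set P)" by (auto simp: Os_def permutations_of_set_def)
    show "finite (\<Union>P\<in>PP. permutations_of_set P)" using fPP by simp
  qed
  have "?lhs = (\<Sum>P\<in>PP. \<Sum>G | G \<in> {G. G \<subseteq> edges_on V \<and> R (component_sizes V G)} \<and> components V G = P. r ^ card G)"
    by (rule sum.group[symmetric])
       (use fPP finite_edges_on[OF fin] partition_on_components in \<open>auto simp: PP_def component_sizes_def\<close>)
  also have "\<dots> = (\<Sum>P\<in>PP. \<Prod>A\<in>P. b (card A))"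
  proof (rule sum.cong[OF refl])
    fix P assume P: "P \<in> PP"
    then have "{G. G \<in> {G. G \<subseteq> edges_on V \<and> R (component_sizes V G)} \<and> components V G = P} =
        {G. G \<subseteq> edges_on V \<and> components V G = P}"
      by (auto simp: PP_def component_sizes_def)
    then show "(\<Sum>G | G \<in> {G. G \<subseteq> edges_on V \<and> R (component_sizes V G)} \<and> components V G = P. r ^ card G)
        = (\<Prod>A\<in>P. b (card A))"
      using P sum_components_eq[OF fin, of P r] b fA
      by (auto simp: PP_def intro!: prod.cong)
  qed
  \<comment> \<open>\<open>F (map card As)\<close> takes the same value on all
    \<open>fact (card P)\<close> orderings of \<open>P\<close>, so the inner sum returns the product
    over the blocks.\<close>
  also have "\<dots> = (\<Sum>P\<in>PP. \<Sum>As | As \<in> Os \<and> set As = P. F (map card As))"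
  proof (rule sum.cong[OF refl])
    fix P assume P: "P \<in> PP"
    have "F (map card As) = (\<Prod>A\<in>P. b (card A)) / fact (card P)" if "As \<in> permutations_of_set P" for As
      using that by (auto simp: F_def permutations_of_set_def prod.distinct_set_conv_list distinct_card comp_def)
    then show "(\<Prod>A\<in>P. b (card A)) = (\<Sum>As | As \<in> Os \<and> set As = P. F (map card As))"
      unfolding perms[OF P] using fP[OF P] by simp
  qed
  also have "\<dots> = (\<Sum>As\<in>Os. F (map card As))"
    by (rule sum.group) (use fOO fPP in \<open>auto simp: Os_def\<close>)
  also have "\<dots> = (\<Sum>ks\<in>{ks \<in> compositions (card V). R (mset ks)}. \<Sum>As | As \<in> Os \<and> map card As = ks. F (map card As))"
  proof (rule sum.group[symmetric, OF fOO])
    show "finite {ks \<in> compositions (card V). R (mset ks)}" using finite_compositions by simp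
    show "map card ` Os \<subseteq> {ks \<in> compositions (card V). R (mset ks)}"
    proof
      fix ks assume "ks \<in> map card ` Os"
      then obtain As where As: "ks = map card As" "distinct As" "partition_on V (set As)"
          "R (image_mset card (mset_set (set As)))"
        by (auto simp: Os_def PP_def)
      have "0 \<notin> set ks"
        using As fA by (auto simp: partition_on_def)
      moreover have "sum_list ks = card V"
      proof -
        have "sum_list ks = (\<Sum>A\<in>set As. card A)"
          using As by (simp add: sum_list_distinct_conv_sum_set)
        also have "\<dots> = card (\<Union>(set As))"
          by (rule card_Union_disjoint[symmetric]) (use As fA in \<open>auto simp: partition_on_def\<close>)
        finally show ?thesis using As by (simp add: partition_on_def)
      qed
      ultimately show "ks \<in> {ks \<in> compositions (card V). R (mset ks)}"
        using As by (auto simp: compositions_def mset_set_set)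
    qed
  qed
  also have "\<dots> = ?rhs"
  proof (rule sum.cong[OF refl])
    fix ks assume ks: "ks \<in> {ks \<in> compositions (card V). R (mset ks)}"
    \<comment> \<open>Once \<open>ks\<close> is fixed, the condition \<open>R\<close> on the sizes
      holds automatically, so the fibre consists of all ordered partitions with sizes
      \<open>ks\<close>.\<close>
    have "{As. As \<in> Os \<and> map card As = ks} = ordered_partitions V ks"
      using ks by (auto simp: Os_def PP_def ordered_partitions_def mset_set_set)
    then have "(\<Sum>As | As \<in> Os \<and> map card As = ks. F (map card As)) = card (ordered_partitions V ks) * F ks"
      by (simp add: ordered_partitions_def)
    also have "\<dots> = fact (card V) / fact (length ks) * ((\<Prod>k\<leftarrow>ks. b k) / (\<Prod>k\<leftarrow>ks. fact k))"
      using card_ordered_partitions[OF fin, of ks] ks by (simp add: F_def)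
    also have "(\<Prod>k\<leftarrow>ks. b k) / (\<Prod>k\<leftarrow>ks. fact k) = (\<Prod>k\<leftarrow>ks. b k / fact k)"
      by (induction ks) (simp_all flip: times_divide_times_eq)
    finally show "(\<Sum>As | As \<in> Os \<and> map card As = ks. F (map card As)) =
        fact (card V) / fact (length ks) * (\<Prod>k\<leftarrow>ks. conn_sum r {1..k} / fact k)"
      by (simp add: b_def)
  qed
  finally show ?thesis .
qed

section \<open>The law of the random graph\<close>

lemma all_edges_eq: "all_edges n = edges_on {1..n}"
  by (simp add: all_edges_def edges_on_def)

lemma pmf_gnp:
  assumes p: "0 < p" "p < 1" and G: "G \<subseteq> edges_on {1..n}"
  shows "pmf (gnp n p) G = (1 - p) ^ (n choose 2) * (p / (1 - p)) ^ card G"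
proof -
  let ?E = "edges_on {1..n}" and ?B = "Pi_pmf (edges_on {1..n}) False (\<lambda>_. bernoulli_pmf p)"
  let ?f = "\<lambda>present. {e \<in> ?E. present e}"
  have fin: "finite ?E" by (rule finite_edges_on) simp
  have pmf: "pmf ?B (\<lambda>e. e \<in> G) = p ^ card G * (1 - p) ^ card (?E - G)"
  proof -
    have "pmf ?B (\<lambda>e. e \<in> G) = (\<Prod>e\<in>?E. if e \<in> G then p else 1 - p)"
      using p G by (subst pmf_Pi'[OF fin]) (auto intro!: prod.cong)
    also have "\<dots> = p ^ card (?E \<inter> {e. e \<in> G}) * (1 - p) ^ card (?E \<inter> - {e. e \<in> G})"
      by (subst prod.If_cases[OF fin]) simp
    also have "?E \<inter> {e. e \<in> G} = G" using G by auto
    also have "?E \<inter> - {e. e \<in> G} = ?E - G" by auto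
    finally show ?thesis .
  qed
  then have "(\<lambda>e. e \<in> G) \<in> set_pmf ?B" using p by (simp add: set_pmf_iff)
  \<comment> \<open>Functions in the support take the default value \<open>False\<close> outside
    \<open>?E\<close>, so the edge set determines them.\<close>
  moreover have "inj_on ?f (set_pmf ?B)"
  proof (rule inj_onI, rule ext)
    fix g h e assume "g \<in> set_pmf ?B" "h \<in> set_pmf ?B" and eq: "?f g = ?f h"
    then have "e \<notin> ?E \<Longrightarrow> \<not> g e \<and> \<not> h e" using set_Pi_pmf_subset[OF fin] by fastforce
    then show "g e = h e" using eq by (cases "e \<in> ?E") blast+
  qed
  ultimately have "pmf (gnp n p) (?f (\<lambda>e. e \<in> G)) = pmf ?B (\<lambda>e. e \<in> G)"
    unfolding gnp_def all_edges_eq by (rule pmf_map_inj[rotated])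
  also have "\<dots> = p ^ card G * (1 - p) ^ card (?E - G)" by (rule pmf)
  also have "card (?E - G) = (n choose 2) - card G"
    using card_edges_on[of "{1..n}"] G finite_subset[OF G fin] by (simp add: card_Diff_subset)
  \<comment> \<open>This bound makes the truncated subtraction exact, so that the power splits into
    a quotient.\<close>
  also have "card G \<le> n choose 2"
    using card_mono[OF fin G] card_edges_on[of "{1..n}"] by simp
  then have "p ^ card G * (1 - p) ^ ((n choose 2) - card G) = (1 - p) ^ (n choose 2) * (p / (1 - p)) ^ card G"
    using p by (simp add: power_diff power_divide)
  finally show ?thesis using G by (simp add: Collect_conj_eq Int_absorb1)
qed

text \<open>The support consists of edge sets on \<open>{1..n}\<close>, so every probability is a
  finite sum with a common normalising factor.\<close>

lemma prob_gnp:
  assumes p: "0 < p" "p < 1"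
  shows "\<P>(G in measure_pmf (gnp n p). Q G) =
    (1 - p) ^ (n choose 2) * (\<Sum>G | G \<subseteq> edges_on {1..n} \<and> Q G. (p / (1 - p)) ^ card G)"
proof -
  have fin: "finite {G. G \<subseteq> edges_on {1..n} \<and> Q G}" by (simp add: finite_edges_on)
  have "AE G in measure_pmf (gnp n p). G \<subseteq> edges_on {1..n}"
    by (auto simp: AE_measure_pmf_iff gnp_def all_edges_eq)
  then have "\<P>(G in measure_pmf (gnp n p). Q G) =
      measure_pmf.prob (gnp n p) {G. G \<subseteq> edges_on {1..n} \<and> Q G}"
    by (intro measure_pmf.finite_measure_eq_AE) auto
  also have "\<dots> = (\<Sum>G | G \<subseteq> edges_on {1..n} \<and> Q G. pmf (gnp n p) G)"
    by (rule measure_measure_pmf_finite[OF fin])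
  also have "\<dots> = (\<Sum>G | G \<subseteq> edges_on {1..n} \<and> Q G. (1 - p) ^ (n choose 2) * (p / (1 - p)) ^ card G)"
    by (rule sum.cong) (auto simp: pmf_gnp[OF p])
  finally show ?thesis by (simp add: sum_distrib_left)
qed

lemma mu_eq:
  assumes "0 < p" "p < 1"
  shows "mu k p = (1 - p) ^ (k choose 2) * conn_sum (p / (1 - p)) {1..k}"
  unfolding mu_def prob_gnp[OF assms] conn_sum_def conn_graphs_def ..

lemma prob_gnp_component_sizes:
  assumes "0 < p" "p < 1"
  shows "\<P>(G in measure_pmf (gnp n p). R (component_sizes {1..n} G)) =
    (1 - p) ^ (n choose 2) * (\<Sum>ks\<in>{ks \<in> compositions n. R (mset ks)}.
       fact n / fact (length ks) * (\<Prod>k\<leftarrow>ks. conn_sum (p / (1 - p)) {1..k} / fact k))"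
  unfolding prob_gnp[OF assms] using sum_graphs_by_component_sizes[of "{1..n}"] by simp

section \<open>The weights of the sampled sizes\<close>

text \<open>The exponent in \<open>weight\<close> can be a half-integer; the natural power must
  become a \<open>powr\<close> before the two can be combined.\<close>

lemma powr_choose_two:
  assumes "(q :: real) > 0"
  shows "q ^ (n choose 2) = q powr ((real n)\<^sup>2 / 2 - real n / 2)"
proof -
  have "real (n choose 2) = real (n * (n - 1)) / 2"
    using choose_two[of n] real_of_nat_div[of 2 "n * (n - 1)"] by (cases n) simp_all
  also have "\<dots> = (real n)\<^sup>2 / 2 - real n / 2"
    by (cases n) (auto simp: power2_eq_square field_simps)
  finally show ?thesis using assms powr_realpow[of q "n choose 2"] by metis
qed

text \<open>The exponent \<open>k choose 2\<close> contributed by \<open>mu\<close> cancels the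
  quadratic term \<open>- k^2 / 2\<close>. What remains is linear in \<open>k\<close>, so in a
  product over a sequence these powers depend only on the sum.\<close>

lemma weight_eq:
  assumes "0 < c" "c < real n"
  shows "weight n c k = real n ^ (k - 1) * (1 - c / real n) powr (real k * (real n - 1 / 2)) *
    (conn_sum ((c / real n) / (1 - c / real n)) {1..k} / fact k)"
proof -
  have q: "1 - c / real n > 0" using assms by (simp add: field_simps)
  have p: "0 < c / real n" "c / real n < 1" using assms by auto
  have "(1 - c / real n) ^ (k choose 2) * (1 - c / real n) powr (real k * real n - (real k)\<^sup>2 / 2) =
      (1 - c / real n) powr (real k * (real n - 1 / 2))"
    unfolding powr_choose_two[OF q] powr_add[symmetric] by (simp add: algebra_simps)
  then show ?thesis
    unfolding weight_def mu_eq[OF p] by (simp add: ac_simps)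
qed

lemma prod_weight:
  assumes c: "0 < c" "c < real n" and ks: "0 \<notin> set ks"
  shows "real n ^ length ks * (\<Prod>k\<leftarrow>ks. weight n c k) =
    real n ^ sum_list ks * (1 - c / real n) powr (real (sum_list ks) * (real n - 1 / 2)) *
    (\<Prod>k\<leftarrow>ks. conn_sum ((c / real n) / (1 - c / real n)) {1..k} / fact k)"
  using ks
proof (induction ks)
  case Nil
  then show ?case using c by simp
next
  case (Cons k ks)
  have "real n ^ length (k # ks) * (\<Prod>k\<leftarrow>k # ks. weight n c k) =
      (real n * weight n c k) * (real n ^ length ks * (\<Prod>k\<leftarrow>ks. weight n c k))"
    by simp
  also have "real n ^ length ks * (\<Prod>k\<leftarrow>ks. weight n c k) = real n ^ sum_list ks *
      (1 - c / real n) powr (real (sum_list ks) * (real n - 1 / 2)) *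
      (\<Prod>k\<leftarrow>ks. conn_sum ((c / real n) / (1 - c / real n)) {1..k} / fact k)"
    using Cons by simp
  \<comment> \<open>The extra factor \<open>n\<close>, which will come from the Poisson mean, turns
    \<open>n ^ (k - 1)\<close> into \<open>n ^ k\<close>; this uses \<open>k > 0\<close>.\<close>
  also have "real n * weight n c k = real n ^ k * (1 - c / real n) powr (real k * (real n - 1 / 2)) *
      (conn_sum ((c / real n) / (1 - c / real n)) {1..k} / fact k)"
    using Cons.prems unfolding weight_eq[OF c] by (cases k) auto
  finally show ?case by (simp add: power_add powr_add distrib_right mult_ac)
qed

section \<open>The random sequence of Poisson length\<close>

text \<open>Index 0 of the family \<open>X(0 := N)\<close> carries \<open>N\<close>, so a single
  independence assumption covers the length and all entries. Fixing the list constrains only the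
  indices up to its length.\<close>

lemma (in prob_space) prob_random_list_eq:
  fixes N :: "'a \<Rightarrow> nat" and X :: "nat \<Rightarrow> 'a \<Rightarrow> nat"
  assumes indep: "indep_vars (\<lambda>_. count_space UNIV) (X(0 := N)) UNIV"
  shows "{\<omega> \<in> space M. map (\<lambda>i. X i \<omega>) [1..<Suc (N \<omega>)] = ks} \<in> events"
    and "\<P>(\<omega> in M. map (\<lambda>i. X i \<omega>) [1..<Suc (N \<omega>)] = ks) =
      \<P>(\<omega> in M. N \<omega> = length ks) * (\<Prod>i<length ks. \<P>(\<omega> in M. X (Suc i) \<omega> = ks ! i))"
proof -
  let ?Y = "X(0 := N)" and ?l = "length ks"
  \<comment> \<open>Entries are sampled from index 1 but lists are indexed from 0, hence the shift
    \<open>i - 1\<close>.\<close>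
  define A where "A i = (if i = 0 then {?l} else {ks ! (i - 1)})" for i
  have list: "map (\<lambda>i. X i \<omega>) [1..<Suc (N \<omega>)] = ks \<longleftrightarrow>
      N \<omega> = ?l \<and> (\<forall>i<?l. X (Suc i) \<omega> = ks ! i)" for \<omega>
    by (auto simp: list_eq_iff_nth_eq simp del: upt_Suc)
  have "{..?l} = insert 0 (Suc ` {..<?l})"
    using lessThan_Suc_eq_insert_0[of ?l] by (simp add: lessThan_Suc_atMost)
  then have eq: "{\<omega> \<in> space M. map (\<lambda>i. X i \<omega>) [1..<Suc (N \<omega>)] = ks} =
      (\<Inter>i\<in>{..?l}. ?Y i -` A i \<inter> space M)"
    unfolding list by (auto simp: A_def)
  have meas: "?Y i \<in> measurable M (count_space UNIV)" for i
    using indep by (auto simp: indep_vars_def)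
  show "{\<omega> \<in> space M. map (\<lambda>i. X i \<omega>) [1..<Suc (N \<omega>)] = ks} \<in> events"
    unfolding eq by (intro sets.finite_INT measurable_sets[OF meas]) auto
  have "\<P>(\<omega> in M. map (\<lambda>i. X i \<omega>) [1..<Suc (N \<omega>)] = ks) = (\<Prod>i\<le>?l. prob (?Y i -` A i \<inter> space M))"
    unfolding eq using indep by (rule indep_varsD) auto
  also have "\<dots> = prob (N -` {?l} \<inter> space M) * (\<Prod>i<?l. prob (X (Suc i) -` {ks ! i} \<inter> space M))"
    unfolding prod.atMost_shift by (simp add: A_def)
  finally show "\<P>(\<omega> in M. map (\<lambda>i. X i \<omega>) [1..<Suc (N \<omega>)] = ks) =
      \<P>(\<omega> in M. N \<omega> = ?l) * (\<Prod>i<?l. \<P>(\<omega> in M. X (Suc i) \<omega> = ks ! i))"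
    by (simp add: vimage_def Int_def conj_commute)
qed

section \<open>Graph statistics as functions of the multiset of component sizes\<close>

text \<open>Components are nonempty, which gives the lower bound 1, and \<open>n \<ge> 1\<close>
  ensures that the maximum is over a nonempty set. The right-hand side matches the range of the
  sampled sizes.\<close>

lemma max_component_size_le_iff:
  assumes "n \<ge> 1"
  shows "max_component_size n G \<le> m \<longleftrightarrow> set_mset (component_sizes {1..n} G) \<subseteq> {1..m}"
proof -
  have P: "partition_on {1..n} (components {1..n} G)" by (rule partition_on_components)
  then have fin: "finite (components {1..n} G)" by (rule finite_elements[rotated]) simp
  have ne: "components {1..n} G \<noteq> {}" using P assms by (auto simp: partition_on_def)
  have "card A > 0" if "A \<in> components {1..n} G" for A
  proof -
    have "A \<noteq> {}" "A \<subseteq> {1..n}" using P that by (auto simp: partition_on_def)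
    then show ?thesis using finite_subset[of A "{1..n}"] by (simp add: card_gt_0_iff)
  qed
  then show ?thesis
    using fin ne by (auto simp: max_component_size_def component_sizes_def Suc_le_eq)
qed

lemma finite_components: "finite V \<Longrightarrow> finite (components V G)"
  by (simp add: components_def)

lemma num_components_of_size_eq: "num_components_of_size n k G = count (component_sizes {1..n} G) k"
  by (simp add: num_components_of_size_def component_sizes_def count_image_mset_eq_card_vimage finite_components)

lemma num_components_eq: "num_components n G = size (component_sizes {1..n} G)"
  by (simp add: num_components_def component_sizes_def)

lemma max_component_size_eq: "max_component_size n G = Max (set_mset (component_sizes {1..n} G))"
  by (simp add: max_component_size_def component_sizes_def finite_components)

section \<open>Comparison of the sampled sizes with the component sizes\<close>

text \<open>The predicate \<open>R\<close> is arbitrary and the factor does not depend on it; each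
  statistic in the theorem is then an instance, and \<open>R\<close> identically true gives the
  probability of the conditioning event.\<close>

lemma (in prob_space) prob_sample_eq_prob_gnp:
  fixes c \<theta> :: real and n m :: nat and N :: "'a \<Rightarrow> nat" and X :: "nat \<Rightarrow> 'a \<Rightarrow> nat"
  assumes c: "0 < c" "c < real n" and \<theta>: "1 \<le> \<theta> * real n" and m: "m = cutoff \<theta> n"
    and indep: "indep_vars (\<lambda>_. count_space UNIV) (X(0 := N)) UNIV"
    and X: "\<And>i k. i \<ge> 1 \<Longrightarrow> \<P>(\<omega> in M. X i \<omega> = k) = X_law n c \<theta> k"
    and N: "distr M (count_space UNIV) N = measure_pmf (poisson_pmf (Z n c \<theta> * real n))"
  shows "\<P>(\<omega> in M. R (image_mset (\<lambda>i. X i \<omega>) (mset_set {1..N \<omega>})) \<and> (\<Sum>i = 1..N \<omega>. X i \<omega>) = n) =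
    exp (- Z n c \<theta> * real n) * real n ^ n * (1 - c / real n) powr ((real n)\<^sup>2 / 2) / fact n
      * \<P>(G in measure_pmf (gnp n (c / real n)).
          R (component_sizes {1..n} G) \<and> max_component_size n G \<le> m)"
proof -
  define q where "q = 1 - c / real n"
  define z where "z = Z n c \<theta>"
  define B where "B ks = (\<Prod>k\<leftarrow>ks. conn_sum ((c / real n) / (1 - c / real n)) {1..k} / fact k)" for ks :: "nat list"
  define L where "L \<omega> = map (\<lambda>i. X i \<omega>) [1..<Suc (N \<omega>)]" for \<omega>
  define T where "T = {ks \<in> compositions n. R (mset ks) \<and> set_mset (mset ks) \<subseteq> {1..m}}"
  have q: "q > 0" using c by (simp add: q_def field_simps)
  have z: "z > 0" unfolding z_def using c \<theta> by (rule Z_pos)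
  have n: "n \<ge> 1" using c by (cases n) auto
  have finT: "finite T" using finite_compositions by (simp add: T_def)
  have L_mset: "mset (L \<omega>) = image_mset (\<lambda>i. X i \<omega>) (mset_set {1..N \<omega>})" for \<omega>
    unfolding L_def by (simp add: mset_map mset_upt atLeastLessThanSuc_atLeastAtMost del: upt_Suc)
  have L_sum: "sum_list (L \<omega>) = (\<Sum>i = 1..N \<omega>. X i \<omega>)" for \<omega>
    unfolding sum_mset_sum_list[symmetric] L_mset by (simp add: sum_unfold_sum_mset)
  have meas: "(X(0 := N)) i \<in> measurable M (count_space UNIV)" for i
    using indep by (auto simp: indep_vars_def)
  have mN: "N \<in> measurable M (count_space UNIV)" using meas[of 0] by simp
  have mX: "X i \<in> measurable M (count_space UNIV)" if "i \<ge> 1" for i using meas[of i] that by simp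
  have L_events: "{\<omega> \<in> space M. L \<omega> = ks} \<in> events" for ks
    unfolding L_def using indep by (rule prob_random_list_eq)
  \<comment> \<open>Lists of naturals form a countable type, so measurability needs to be checked on
    single lists only.\<close>
  have mL: "L \<in> measurable M (count_space UNIV)"
    by (subst measurable_count_space_eq2_countable)
       (use L_events in \<open>auto simp: vimage_def Int_def conj_commute\<close>)
  \<comment> \<open>\<open>X_law\<close> vanishes outside \<open>{1..m}\<close>; countably many null
    events combine into one.\<close>
  have AE_X: "AE \<omega> in M. \<forall>i\<ge>1. X i \<omega> \<in> {1..m}"
  proof -
    have "AE \<omega> in M. X i \<omega> \<noteq> k" if "i \<ge> 1" "k \<notin> {1..m}" for i k
    proof -
      have "\<P>(\<omega> in M. X i \<omega> = k) = 0" using that m by (auto simp: X X_law_def)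
      moreover have "{\<omega> \<in> space M. X i \<omega> = k} \<in> events"
        using measurable_sets[OF mX[OF that(1)], of "{k}"] by (simp add: vimage_def Int_def conj_commute)
      ultimately show ?thesis by (simp add: prob_Collect_eq_0)
    qed
    then have "AE \<omega> in M. \<forall>i k. i \<ge> 1 \<longrightarrow> k \<notin> {1..m} \<longrightarrow> X i \<omega> \<noteq> k"
      by (simp add: AE_all_countable)
    then show ?thesis by eventually_elim blast
  qed
  have prob_N: "\<P>(\<omega> in M. N \<omega> = l) = (z * real n) ^ l / fact l * exp (- (z * real n))" for l
  proof -
    have "\<P>(\<omega> in M. N \<omega> = l) = measure (distr M (count_space UNIV) N) {l}"
      using mN by (simp add: measure_distr vimage_def Int_def conj_commute)
    also have "\<dots> = pmf (poisson_pmf (z * real n)) l"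
      unfolding N z_def by (simp add: measure_pmf_single)
    finally show ?thesis using z n by simp
  qed
  \<comment> \<open>The power \<open>z ^ l\<close> in the Poisson mass cancels the normalisation of
    the \<open>l\<close> laws, while its \<open>1 / l!\<close> plays the role of the orderings of
    the components.\<close>
  have prob_L: "\<P>(\<omega> in M. L \<omega> = ks) =
      exp (- z * real n) * real n ^ n * q powr (real n * (real n - 1 / 2)) / fact (length ks) * B ks"
    if ks: "ks \<in> T" for ks
  proof -
    have ks': "set ks \<subseteq> {1..m}" "0 \<notin> set ks" "sum_list ks = n"
      using ks by (auto simp: T_def compositions_def)
    have "(\<Prod>i<length ks. \<P>(\<omega> in M. X (Suc i) \<omega> = ks ! i)) = (\<Prod>i<length ks. weight n c (ks ! i) / z)"
      using ks'(1) m by (intro prod.cong refl) (auto simp: X X_law_def z_def dest!: nth_mem)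
    also have "\<dots> = (\<Prod>k\<leftarrow>ks. weight n c k) / z ^ length ks"
      by (simp add: prod_dividef prod.list_conv_set_nth atLeast0LessThan)
    finally have "\<P>(\<omega> in M. L \<omega> = ks) = exp (- (z * real n)) / fact (length ks) *
        (real n ^ length ks * (\<Prod>k\<leftarrow>ks. weight n c k))"
      unfolding L_def prob_random_list_eq(2)[OF indep] prob_N using z by (simp add: power_mult_distrib)
    then show ?thesis
      unfolding prod_weight[OF c ks'(2)] ks'(3) B_def q_def by simp
  qed
  \<comment> \<open>The events agree only almost surely: outside the null set of \<open>AE_X\<close>
    a sampled list could have entries beyond \<open>{1..m}\<close>.\<close>
  have "\<P>(\<omega> in M. R (mset (L \<omega>)) \<and> sum_list (L \<omega>) = n) = prob (\<Union>ks\<in>T. {\<omega> \<in> space M. L \<omega> = ks})"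
  proof (rule finite_measure_eq_AE)
    show "AE \<omega> in M. \<omega> \<in> {\<omega> \<in> space M. R (mset (L \<omega>)) \<and> sum_list (L \<omega>) = n} \<longleftrightarrow>
        \<omega> \<in> (\<Union>ks\<in>T. {\<omega> \<in> space M. L \<omega> = ks})"
      using AE_X
    proof eventually_elim
      case (elim \<omega>)
      then have "set (L \<omega>) \<subseteq> {1..m}" by (auto simp: L_def simp del: upt_Suc)
      then show ?case by (auto simp: T_def compositions_def)
    qed
    show "{\<omega> \<in> space M. R (mset (L \<omega>)) \<and> sum_list (L \<omega>) = n} \<in> events"
      using measurable_sets[OF mL, of "{ks. R (mset ks) \<and> sum_list ks = n}"]
      by (simp add: vimage_def Int_def conj_commute)
    show "(\<Union>ks\<in>T. {\<omega> \<in> space M. L \<omega> = ks}) \<in> events"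
      using finT L_events by auto
  qed
  also have "\<dots> = (\<Sum>ks\<in>T. \<P>(\<omega> in M. L \<omega> = ks))"
    by (rule finite_measure_finite_Union)
       (use finT L_events in \<open>auto simp: disjoint_family_on_def\<close>)
  also have "\<dots> = exp (- z * real n) * real n ^ n * q powr ((real n)\<^sup>2 / 2) / fact n *
      (q ^ (n choose 2) * (\<Sum>ks\<in>T. fact n / fact (length ks) * B ks))"
  proof -
    \<comment> \<open>The exponent splits as \<open>n^2 / 2\<close> plus \<open>n choose 2\<close>;
      the second part is the normalising factor of the graph law.\<close>
    have "q powr (real n * (real n - 1 / 2)) = q powr ((real n)\<^sup>2 / 2) * q ^ (n choose 2)"
      unfolding powr_choose_two[OF q] powr_add[symmetric] by (simp add: power2_eq_square algebra_simps)
    then show ?thesis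
      unfolding sum_distrib_left by (intro sum.cong refl) (simp add: prob_L)
  qed
  also have "q ^ (n choose 2) * (\<Sum>ks\<in>T. fact n / fact (length ks) * B ks) =
      \<P>(G in measure_pmf (gnp n (c / real n)).
          R (component_sizes {1..n} G) \<and> set_mset (component_sizes {1..n} G) \<subseteq> {1..m})"
    unfolding q_def T_def B_def
    using c by (subst prob_gnp_component_sizes[where R = "\<lambda>S. R S \<and> set_mset S \<subseteq> {1..m}"]) simp_all
  finally show ?thesis
    unfolding L_sum L_mset z_def q_def max_component_size_le_iff[OF n] .
qed

theorem proposition1:
  fixes c \<theta> :: real and n m :: nat
    and M :: "'a measure" and N :: "'a \<Rightarrow> nat" and X :: "nat \<Rightarrow> 'a \<Rightarrow> nat"
  assumes "c > 0" and "0 < \<theta>" and "\<theta> \<le> 1" and "real n > c" and "\<theta> * real n \<ge> 1"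
    and "m = cutoff \<theta> n"
    and "prob_space M"
    and "prob_space.indep_vars M (\<lambda>_. count_space UNIV) (X(0 := N)) UNIV"
    and "\<And>i k. i \<ge> 1 \<Longrightarrow> \<P>(\<omega> in M. X i \<omega> = k) = X_law n c \<theta> k"
    and "distr M (count_space UNIV) N = measure_pmf (poisson_pmf (Z n c \<theta> * real n))"
  shows
    "(\<forall>\<gamma> :: nat \<Rightarrow> nat. (\<Sum>k = 1..m. k * \<gamma> k) = n \<longrightarrow>
        \<P>(G in measure_pmf (gnp n (c / real n)).
            \<forall>k\<in>{1..m}. num_components_of_size n k G = \<gamma> k \<bar> max_component_size n G \<le> m)
        = \<P>(\<omega> in M.
            \<forall>k\<in>{1..m}. (\<Sum>i = 1..N \<omega>. of_bool (X i \<omega> = k)) = \<gamma> k \<bar> (\<Sum>i = 1..N \<omega>. X i \<omega>) = n))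
     \<and> \<P>(\<omega> in M. (\<Sum>i = 1..N \<omega>. X i \<omega>) = n)
        = exp (- Z n c \<theta> * real n) * real n ^ n * (1 - c / real n) powr ((real n)\<^sup>2 / 2) / fact n
          * \<P>(G in measure_pmf (gnp n (c / real n)). max_component_size n G \<le> m)
     \<and> (\<forall>j\<in>{1..m}.
        \<P>(G in measure_pmf (gnp n (c / real n)).
            max_component_size n G = j \<bar> max_component_size n G \<le> m)
        = \<P>(\<omega> in M. Max ((\<lambda>i. X i \<omega>) ` {1..N \<omega>}) = j \<bar> (\<Sum>i = 1..N \<omega>. X i \<omega>) = n))
     \<and> (\<forall>l\<ge>1.
        \<P>(G in measure_pmf (gnp n (c / real n)).
            num_components n G = l \<bar> max_component_size n G \<le> m)
        = \<P>(\<omega> in M. N \<omega> = l \<bar> (\<Sum>i = 1..N \<omega>. X i \<omega>) = n))"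
proof -
  define K where "K = exp (- Z n c \<theta> * real n) * real n ^ n * (1 - c / real n) powr ((real n)\<^sup>2 / 2) / fact n"
  define S where "S \<omega> = image_mset (\<lambda>i. X i \<omega>) (mset_set {1..N \<omega>})" for \<omega>
  let ?gnp = "measure_pmf (gnp n (c / real n))"
  have key: "\<P>(\<omega> in M. R (S \<omega>) \<and> (\<Sum>i = 1..N \<omega>. X i \<omega>) = n) =
      K * \<P>(G in ?gnp. R (component_sizes {1..n} G) \<and> max_component_size n G \<le> m)" for R
    unfolding S_def K_def by (rule prob_space.prob_sample_eq_prob_gnp[OF assms(7,1,4,5,6,8,9,10)])
  have "0 < real n" "c / real n < 1" using assms(1,4) by auto
  then have K: "K > 0" by (simp add: K_def)
  have total: "\<P>(\<omega> in M. (\<Sum>i = 1..N \<omega>. X i \<omega>) = n) = K * \<P>(G in ?gnp. max_component_size n G \<le> m)"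
    using key[of "\<lambda>_. True"] by simp
  \<comment> \<open>Numerator and denominator of the conditional probability carry the same factor
    \<open>K > 0\<close>, which cancels.\<close>
  have cond: "\<P>(G in ?gnp. R (component_sizes {1..n} G) \<bar> max_component_size n G \<le> m) =
      \<P>(\<omega> in M. R (S \<omega>) \<bar> (\<Sum>i = 1..N \<omega>. X i \<omega>) = n)" for R
    unfolding cond_prob_def total key[of R] using K by simp
  have count_S: "(\<Sum>i = 1..N \<omega>. of_bool (X i \<omega> = k)) = count (S \<omega>) k" for \<omega> k
    by (simp add: S_def count_image_mset_eq_card_vimage sum_of_bool_eq Int_def)
  \<comment> \<open>When \<open>N\<close> is 0, both sides are \<open>Max\<close> of the empty set;
    such outcomes lie outside the conditioning event because \<open>n > 0\<close>.\<close>
  have max_S: "Max ((\<lambda>i. X i \<omega>) ` {1..N \<omega>}) = Max (set_mset (S \<omega>))" for \<omega>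
    by (simp add: S_def)
  have size_S: "N \<omega> = size (S \<omega>)" for \<omega>
    by (simp add: S_def)
  show ?thesis
  proof (intro conjI allI ballI impI)
    fix \<gamma> :: "nat \<Rightarrow> nat"
    show "\<P>(G in ?gnp. \<forall>k\<in>{1..m}. num_components_of_size n k G = \<gamma> k \<bar> max_component_size n G \<le> m)
        = \<P>(\<omega> in M. \<forall>k\<in>{1..m}. (\<Sum>i = 1..N \<omega>. of_bool (X i \<omega> = k)) = \<gamma> k \<bar>
            (\<Sum>i = 1..N \<omega>. X i \<omega>) = n)"
      unfolding num_components_of_size_eq count_S by (rule cond)
  next
    show "\<P>(\<omega> in M. (\<Sum>i = 1..N \<omega>. X i \<omega>) = n)
        = exp (- Z n c \<theta> * real n) * real n ^ n * (1 - c / real n) powr ((real n)\<^sup>2 / 2) / fact n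
          * \<P>(G in ?gnp. max_component_size n G \<le> m)"
      using total unfolding K_def .
  next
    fix j
    show "\<P>(G in ?gnp. max_component_size n G = j \<bar> max_component_size n G \<le> m)
        = \<P>(\<omega> in M. Max ((\<lambda>i. X i \<omega>) ` {1..N \<omega>}) = j \<bar> (\<Sum>i = 1..N \<omega>. X i \<omega>) = n)"
      using cond[of "\<lambda>T. Max (set_mset T) = j"] unfolding max_S max_component_size_eq .
  next
    fix l :: nat
    show "\<P>(G in ?gnp. num_components n G = l \<bar> max_component_size n G \<le> m)
        = \<P>(\<omega> in M. N \<omega> = l \<bar> (\<Sum>i = 1..N \<omega>. X i \<omega>) = n)"
      using cond[of "\<lambda>T. size T = l"] by (simp add: num_components_eq size_S)
  qed
qed

end
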